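(* Explicit cosimulation schemes (without iteration) with polynomial extrapolation of inputs are not linearly stable: for every extrapolation degree $n\ge 0$ and every subsystem integration scheme, the resulting cosimulation method fails to preserve the stability of linear systems, i.e. there are a stable linear system $\dot x=Bx$, a splitting of it into subsystems, and an exchange step size $H>0$ for which the numerical solution produced by the cosimulation method is not stable. Consequently, explicit cosimulation schemes are not B-stable either.
   Context: Explicit cosimulation of a linear system $\dot x=Bx$ split into two subsystems with variables $x_1,x_2$: $$\dot x_1=B_{11}x_1+B_{12}\operatorname{Ext}(x_2),\qquad \dot x_2=B_{22}x_2+B_{21}\operatorname{Ext}(x_1).$$ On each exchange interval $[T_j,T_{j+1})$ of length $H$, $\operatorname{Ext}(x_i)$ is a polynomial in $t$ of degree $n$ extrapolating $x_i$ from data available at the exchange time $T_j$ (for $n=0$ it is the constant $x_i(T_j)$). The two equations are then solved separately on the interval by a consistent one-step integration scheme started from the current values, without iterating or repeating intervals; at $T_{j+1}$ data are exchanged anew. The linear system is called stable if all its solutions remain bounded for $t\to\infty$. A method is called linearly stable if it conserves the stability of linear vector-valued problems $\dot x=Bx$: whenever the linear system is stable, the numerical solutions produced by the method (for any step size) are stable, i.e. remain bounded. A method is called B-stable if it conserves the stability properties of dissipative ODEs: whenever $\langle f(y_1)-f(y_2),y_1-y_2\rangle\le 0$ for all $y_1,y_2$, the discrete evolution is non-expansive, $\|\Psi^{H}y_1-\Psi^{H}y_2\|\le\|y_1-y_2\|$ for all $y_1,y_2$ and all step sizes $H$.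
   Formalization: Besides being consistent, each subsystem scheme is assumed to act as a linear quadrature rule, y + Q_h(g), on right-hand sides g(t) independent of the state (as Runge-Kutta methods do); for merely consistent schemes the claim fails, e.g. for schemes that reset large values to zero. *)

theory Defs
  imports "HOL-Analysis.Analysis"
begin

section \<open>Systems split into two subsystems\<close>

text \<open>A state is a pair: the first component belongs to subsystem 1, the second to subsystem 2.
  The product norm and inner product are the Euclidean ones.\<close>

type_synonym ('a, 'b) state = "(real ^ 'a) \<times> (real ^ 'b)"

definition block_rhs ::
  "real ^ 'a ^ 'a \<Rightarrow> real ^ 'b ^ 'a \<Rightarrow> real ^ 'a ^ 'b \<Rightarrow> real ^ 'b ^ 'b
    \<Rightarrow> ('a::finite, 'b::finite) state \<Rightarrow> ('a, 'b) state" where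
  "block_rhs B11 B12 B21 B22 =
     (\<lambda>(x1, x2). (B11 *v x1 + B12 *v x2, B21 *v x1 + B22 *v x2))"

definition stable_system :: "('v::real_normed_vector \<Rightarrow> 'v) \<Rightarrow> bool" where
  "stable_system f \<longleftrightarrow>
     (\<forall>x. (\<forall>t\<ge>0. (x has_vector_derivative f (x t)) (at t within {0::real..}))
            \<longrightarrow> bounded (x ` {0..}))"

definition dissipative :: "('v::real_inner \<Rightarrow> 'v) \<Rightarrow> bool" where
  "dissipative f \<longleftrightarrow> (\<forall>y1 y2. (f y1 - f y2) \<bullet> (y1 - y2) \<le> 0)"


section \<open>One-step integration schemes\<close>

text \<open>\<open>\<Phi> h f y\<close> is the result of one step of size \<open>h\<close> for \<open>y' = f(\<tau>, y)\<close> from the value \<open>y\<close>.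
  The time \<open>\<tau>\<close> is counted from the beginning of the step, so that a scheme does not depend on
  absolute time.\<close>

type_synonym 'v scheme = "real \<Rightarrow> (real \<Rightarrow> 'v \<Rightarrow> 'v) \<Rightarrow> 'v \<Rightarrow> 'v"

definition consistent :: "('v::real_normed_vector) scheme \<Rightarrow> bool" where
  "consistent \<Phi> \<longleftrightarrow>
     (\<forall>f y. continuous_on UNIV (\<lambda>(\<tau>, u). f \<tau> u) \<and> (\<exists>L. \<forall>\<tau>. L-lipschitz_on UNIV (f \<tau>))
        \<longrightarrow> ((\<lambda>h. (\<Phi> h f y - y) /\<^sub>R h) \<longlongrightarrow> f 0 y) (at_right 0))"

text \<open>On right-hand sides that do not depend on the state, the scheme is a linear quadrature rule,
  as is the case for Runge-Kutta, Taylor, Rosenbrock and exponential methods, and for exact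
  integration. This excludes schemes that react nonlinearly to the size of the data: a scheme
  that returns \<open>y + h f(0,y)\<close> if \<open>h (1 + |y| + |f(0,y)|) \<le> 1\<close> and \<open>0\<close> otherwise is consistent, but
  for each fixed step size it produces bounded sequences only.\<close>

definition linear_quadrature :: "('v::real_normed_vector) scheme \<Rightarrow> bool" where
  "linear_quadrature \<Phi> \<longleftrightarrow>
     (\<exists>Q. \<forall>h>0.
        (\<forall>g y. continuous_on UNIV g \<longrightarrow> \<Phi> h (\<lambda>\<tau> u. g \<tau>) y = y + Q h g) \<and>
        (\<forall>g1 g2 a b. continuous_on UNIV g1 \<longrightarrow> continuous_on UNIV g2 \<longrightarrow>
           Q h (\<lambda>\<tau>. a *\<^sub>R g1 \<tau> + b *\<^sub>R g2 \<tau>) = a *\<^sub>R Q h g1 + b *\<^sub>R Q h g2))"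

definition integration_scheme :: "('v::real_normed_vector) scheme \<Rightarrow> bool" where
  "integration_scheme \<Phi> \<longleftrightarrow> consistent \<Phi> \<and> linear_quadrature \<Phi>"

primrec steps :: "nat \<Rightarrow> 'v scheme \<Rightarrow> 'v scheme" where
  "steps 0 \<Phi> h f y = y"
| "steps (Suc i) \<Phi> h f y = \<Phi> h (\<lambda>\<tau> u. f (real i * h + \<tau>) u) (steps i \<Phi> h f y)"


section \<open>Explicit cosimulation\<close>

text \<open>Exchange times are \<open>T\<^sub>j = j H\<close>. The polynomial used on \<open>[T\<^sub>j, T\<^sub>j\<^sub>+\<^sub>1)\<close> interpolates the last
  \<open>n + 1\<close> exchanged values \<open>x\<^sub>j\<^sub>-\<^sub>n, \<dots>, x\<^sub>j\<close> (Lagrange form); as long as \<open>j < n\<close> it interpolates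
  the values \<open>x\<^sub>0, \<dots>, x\<^sub>j\<close> available so far. For \<open>n = 0\<close> it is the constant \<open>x\<^sub>j\<close>.\<close>

definition extrapolation ::
  "nat \<Rightarrow> real \<Rightarrow> (nat \<Rightarrow> 'v::real_vector) \<Rightarrow> nat \<Rightarrow> real \<Rightarrow> 'v" where
  "extrapolation n H x j t =
     (let N = {j - min n j..j} in
        \<Sum>k\<in>N. (\<Prod>l\<in>N - {k}. (t - real l * H) / (real k * H - real l * H)) *\<^sub>R x k)"

text \<open>A method is given by its numerical solutions: \<open>M f H x\<close> says that \<open>x 0, x 1, \<dots>\<close> is a
  numerical solution of \<open>y' = f y\<close> at the exchange times, for exchange step size \<open>H\<close>.\<close>

type_synonym 'v evolution = "('v \<Rightarrow> 'v) \<Rightarrow> real \<Rightarrow> (nat \<Rightarrow> 'v) \<Rightarrow> bool"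

text \<open>Subsystem \<open>i\<close> performs \<open>k\<^sub>i H\<close> equal scheme steps per exchange interval. For
  \<^term>\<open>f = block_rhs B11 B12 B21 B22\<close> the subsystem equations solved below are
  \<open>x\<^sub>1' = B\<^sub>1\<^sub>1 x\<^sub>1 + B\<^sub>1\<^sub>2 Ext(x\<^sub>2)\<close> and \<open>x\<^sub>2' = B\<^sub>2\<^sub>1 Ext(x\<^sub>1) + B\<^sub>2\<^sub>2 x\<^sub>2\<close>.\<close>

definition cosimulation ::
  "nat \<Rightarrow> (real \<Rightarrow> nat) \<Rightarrow> (real \<Rightarrow> nat) \<Rightarrow> (real ^ 'a) scheme \<Rightarrow> (real ^ 'b) scheme
    \<Rightarrow> ('a::finite, 'b::finite) state evolution" where
  "cosimulation n k1 k2 \<Phi>1 \<Phi>2 f H x \<longleftrightarrow>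
     (\<forall>j. let Ext1 = extrapolation n H (\<lambda>i. fst (x i)) j;
              Ext2 = extrapolation n H (\<lambda>i. snd (x i)) j;
              T = real j * H
          in fst (x (Suc j)) =
               steps (k1 H) \<Phi>1 (H / real (k1 H)) (\<lambda>\<tau> u. fst (f (u, Ext2 (T + \<tau>)))) (fst (x j)) \<and>
             snd (x (Suc j)) =
               steps (k2 H) \<Phi>2 (H / real (k2 H)) (\<lambda>\<tau> u. snd (f (Ext1 (T + \<tau>), u))) (snd (x j)))"


section \<open>Linear stability and B-stability\<close>

definition linearly_stable :: "('a::finite, 'b::finite) state evolution \<Rightarrow> bool" where
  "linearly_stable M \<longleftrightarrow>
     (\<forall>B11 B12 B21 B22. stable_system (block_rhs B11 B12 B21 B22) \<longrightarrow>
        (\<forall>H>0. \<forall>x. M (block_rhs B11 B12 B21 B22) H x \<longrightarrow> bounded (range x)))"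

text \<open>A method with memory \<open>n\<close> advances the data window \<open>(x\<^sub>j\<^sub>-\<^sub>n, \<dots>, x\<^sub>j)\<close>; the discrete evolution
  is required to be non-expansive for the maximum norm on windows. For \<open>n = 0\<close> this is
  \<open>\<parallel>\<Psi> y1 - \<Psi> y2\<parallel> \<le> \<parallel>y1 - y2\<parallel>\<close>. For \<open>n > 0\<close> it is implied by the estimate with
  \<open>\<parallel>x\<^sub>j - y\<^sub>j\<parallel>\<close> on the right-hand side, so that its failure is the stronger assertion.\<close>

definition B_stable :: "nat \<Rightarrow> ('v::real_inner) evolution \<Rightarrow> bool" where
  "B_stable n M \<longleftrightarrow>
     (\<forall>f. continuous_on UNIV f \<and> dissipative f \<longrightarrow>
        (\<forall>H>0. \<forall>x y. M f H x \<and> M f H y \<longrightarrow>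
           (\<forall>j\<ge>n. norm (x (Suc j) - y (Suc j)) \<le> (MAX i\<in>{j - n..j}. norm (x i - y i)))))"

end

theory Submission
  imports Defs "HOL-Computational_Algebra.Fundamental_Theorem_Algebra"
begin

text \<open>The system is a harmonic oscillator of frequency \<open>\<omega>\<close>, with position in subsystem 1 and velocity in
  subsystem 2. It is skew-symmetric, hence stable and dissipative. The diagonal blocks vanish, so an
  integration scheme acts on the extrapolated input only, as a linear quadrature rule
  (\<open>exchange_step_quadrature\<close>), and the cosimulation is a linear recursion
  \<open>u\<^sub>j\<^sub>+\<^sub>1 = u\<^sub>j - \<omega> \<Sum>a\<^sub>i v\<^sub>j\<^sub>-\<^sub>i\<close>, \<open>v\<^sub>j\<^sub>+\<^sub>1 = v\<^sub>j + \<omega> \<Sum>b\<^sub>i u\<^sub>j\<^sub>-\<^sub>i\<close>. Because the scheme is explicit, its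
  amplification is not limited as \<open>\<omega>\<close> grows at a fixed step size.

  With \<open>A(z) = \<Sum>a\<^sub>i z\<^sup>i\<close>, \<open>B(z) = \<Sum>b\<^sub>i z\<^sup>i\<close> and \<open>s = \<omega>\<^sup>2\<close>, the modes of the recursion are the numbers \<open>1/z\<close> for
  the roots \<open>z\<close> of \<open>D(z) = (1 - z)\<^sup>2 + s z\<^sup>2 A(z) B(z)\<close>. The weights can be almost arbitrary, as consistency
  does not control the moments of the quadrature at a fixed step size, but extrapolation
  reproduces constants (\<open>sum_shifted_lagrange\<close>) and consistency makes \<open>A(1)\<close> and \<open>B(1)\<close> positive for small
  steps. A polynomial of bounded degree with \<open>D(0) = 1\<close> and a large value \<open>D(1) = s A(1) B(1)\<close> must have a
  root in the open unit disc (\<open>root_in_unit_disc\<close>), that is, a growing mode.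

  The growing mode must also be present in a trajectory. The initial value leaves no freedom for
  this: it determines the first \<open>n\<close> steps, which extrapolate with lower degree. The start-up values are
  polynomials in \<open>s\<close>, and a bounded trajectory imposes on them a polynomial relation between \<open>s\<close> and
  the root \<open>z\<close>. As \<open>s\<close> is a rational function of \<open>z\<close> by \<open>D(z) = 0\<close>, this relation is a polynomial equation
  for \<open>z\<close>, and it is not trivial, as one sees at \<open>s = 0\<close>, \<open>z = 1\<close>. Hence all but finitely many large \<open>s\<close>
  give unbounded trajectories (\<open>finitely_many_bounded_solutions\<close>).

  For B-stability the unbounded trajectory is compared with the zero solution: if the differences never
  exceeded the maximum over the preceding window, the trajectory would be bounded.\<close>

section \<open>Sequences defined by their whole past\<close>

text \<open>Extrapolation reads several past values, so the discrete problems below are not iterations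
  of one map. Extending the whole history by one entry is, and the diagonal of the iterates is the
  sequence sought.\<close>

lemma course_of_values_recursion:
  fixes F :: "nat \<Rightarrow> (nat \<Rightarrow> 'a) \<Rightarrow> 'a"
  assumes "\<And>j x y. (\<And>i. i \<le> j \<Longrightarrow> x i = y i) \<Longrightarrow> F j x = F j y"
  obtains x where "x 0 = c" and "\<And>j. x (Suc j) = F j x"
proof -
  define X where "X = rec_nat (\<lambda>_. c) (\<lambda>j z. z(Suc j := F j z))"
  have X0: "X 0 = (\<lambda>_. c)" and XS: "X (Suc j) = (X j)(Suc j := F j (X j))" for j
    by (simp_all add: X_def)
  have stable: "X (j + d) j = X j j" for j d
    by (induction d) (simp_all add: XS)
  have "F j (X j) = F j (\<lambda>i. X i i)" for j
  proof (rule assms)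
    fix i assume "i \<le> j"
    then show "X j i = X i i"
      using stable[of i "j - i"] by simp
  qed
  then show thesis
    using that[of "\<lambda>j. X j j"] by (simp add: X0 XS)
qed

section \<open>Roots inside the unit disc\<close>

text \<open>A linear factor \<open>z - r\<close> with \<open>|r| \<ge> 1\<close> satisfies \<open>|1 - r| \<le> 2 |r|\<close>, so a polynomial without roots
  in the disc grows by a factor of at most \<open>2\<close> per degree between \<open>0\<close> and \<open>1\<close>.\<close>

lemma root_in_unit_disc:
  fixes p :: "complex poly"
  assumes "norm (poly p 1) > 2 ^ degree p * norm (poly p 0)"
  obtains z where "norm z < 1" and "poly p z = 0"
proof -
  have "norm (poly p 1) \<le> 2 ^ degree p * norm (poly p 0)"
    if "\<And>z. norm z < 1 \<Longrightarrow> poly p z \<noteq> 0" for p :: "complex poly"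
    using that
  proof (induction "degree p" arbitrary: p)
    case 0
    then obtain c where "p = [:c:]" by (metis degree_eq_zeroE)
    then show ?case by simp
  next
    case (Suc d)
    then have "\<not> constant (poly p)"
      by (simp add: constant_degree)
    then obtain r where r: "poly p r = 0"
      using fundamental_theorem_of_algebra by blast
    then obtain q where q: "p = [:-r, 1:] * q"
      by (metis dvdE poly_eq_0_iff_dvd)
    have "q \<noteq> 0" using Suc.hyps(2) q by auto
    then have deg: "degree p = Suc (degree q)"
      unfolding q by (subst degree_mult_eq) auto
    have r1: "norm r \<ge> 1" using Suc.prems[of r] r by (meson not_le)
    have IH: "norm (poly q 1) \<le> 2 ^ degree q * norm (poly q 0)"
    proof (rule Suc.hyps(1))
      show "d = degree q" using deg Suc.hyps(2) by simp
    qed (use Suc.prems q in fastforce)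
    have "norm (1 - r) \<le> 2 * norm r"
      using norm_triangle_ineq4[of 1 r] r1 by simp
    then have "norm (1 - r) * norm (poly q 1) \<le> (2 * norm r) * (2 ^ degree q * norm (poly q 0))"
      using IH by (intro mult_mono) auto
    moreover have "poly p 1 = (1 - r) * poly q 1" "poly p 0 = - r * poly q 0"
      by (simp_all add: q algebra_simps)
    ultimately show ?case
      by (simp add: deg norm_mult mult_ac del: poly_mult)
  qed
  then show thesis using assms that by (meson not_le)
qed

section \<open>The scalar delay recursion\<close>

text \<open>The component \<open>u\<close> of subsystem 1 and the rescaled component \<open>y = v / \<omega>\<close> of subsystem 2, for
  \<open>s = \<omega>\<^sup>2\<close>. The weight families have a row \<open>m\<close> for each number \<open>m + 1\<close> of available data, since the
  first \<open>n\<close> intervals use lower extrapolation degrees. The rescaling makes all values polynomials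
  in \<open>s\<close> and admits \<open>s = 0\<close>. The parameter is complex because it will be expressed rationally by a
  complex root of the characteristic function.\<close>

definition coupled ::
  "nat \<Rightarrow> (nat \<Rightarrow> nat \<Rightarrow> complex) \<Rightarrow> (nat \<Rightarrow> nat \<Rightarrow> complex) \<Rightarrow> complex
    \<Rightarrow> (nat \<Rightarrow> complex) \<Rightarrow> (nat \<Rightarrow> complex) \<Rightarrow> bool" where
  "coupled n a b s u y \<longleftrightarrow> u 0 = 1 \<and> y 0 = 0 \<and>
     (\<forall>j. u (Suc j) = u j - s * (\<Sum>i\<le>min n j. a (min n j) i * y (j - i)) \<and>
          y (Suc j) = y j + (\<Sum>i\<le>min n j. b (min n j) i * u (j - i)))"

lemma coupled_exists: "\<exists>u y. coupled n a b s u y"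
proof -
  define F where "F = (\<lambda>j (x :: nat \<Rightarrow> complex \<times> complex).
    (fst (x j) - s * (\<Sum>i\<le>min n j. a (min n j) i * snd (x (j - i))),
     snd (x j) + (\<Sum>i\<le>min n j. b (min n j) i * fst (x (j - i)))))"
  have "F j x = F j x'" if "\<And>i. i \<le> j \<Longrightarrow> x i = x' i" for j x x'
    using that by (simp add: F_def)
  then obtain x where "x 0 = (1, 0)" "\<And>j. x (Suc j) = F j x"
    using course_of_values_recursion[of F "(1, 0)"] by blast
  then have "coupled n a b s (fst \<circ> x) (snd \<circ> x)"
    by (simp add: coupled_def F_def)
  then show ?thesis by blast
qed

lemma coupled_unique:
  assumes "coupled n a b s u y" and "coupled n a b s u' y'"
  shows "u j = u' j \<and> y j = y' j"
proof (induction j rule: less_induct)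
  case (less j)
  show ?case
  proof (cases j)
    case 0
    then show ?thesis using assms by (simp add: coupled_def)
  next
    case (Suc m)
    have IH: "u i = u' i" "y i = y' i" if "i \<le> m" for i
      using less that Suc by auto
    show ?thesis
      using assms by (simp add: coupled_def Suc IH)
  qed
qed

text \<open>The start-up intervals differ from the stationary recursion by finitely many terms, which make up
  the first sum on the right. The stationary part is the Cauchy product with the
  symbol \<open>\<Sum>i\<le>n. c n i z\<^sup>i\<close>.\<close>

lemma generating_function_identity:
  fixes c :: "nat \<Rightarrow> nat \<Rightarrow> complex" and x g :: "nat \<Rightarrow> complex"
  assumes rec: "\<And>j. g (Suc j) = g j + k * (\<Sum>i\<le>min n j. c (min n j) i * x (j - i))"
    and g: "summable (\<lambda>j. g j * z ^ j)" and x: "summable (\<lambda>j. x j * z ^ j)"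
  shows "(1 - z) * (\<Sum>j. g j * z ^ j) = g 0 + k * z *
     ((\<Sum>j<n. (\<Sum>i\<le>j. (c j i - c n i) * x (j - i)) * z ^ j)
      + (\<Sum>i\<le>n. c n i * z ^ i) * (\<Sum>j. x j * z ^ j))"
proof -
  define X where "X = (\<Sum>j. x j * z ^ j)"
  define P where "P = (\<Sum>j<n. (\<Sum>i\<le>j. (c j i - c n i) * x (j - i)) * z ^ j)"
  define full where "full j = (\<Sum>i\<le>n. if i \<le> j then c n i * x (j - i) else 0)" for j
  have "(\<lambda>j. if i \<le> j then c n i * x (j - i) * z ^ j else 0) sums (c n i * z ^ i * X)" for i
  proof -
    have "(\<lambda>j. c n i * z ^ i * (x j * z ^ j)) sums (c n i * z ^ i * X)"
      unfolding X_def using x by (intro sums_mult summable_sums)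
    then show ?thesis
      by (subst sums_zero_iff_shift[symmetric, where n = i]) (auto simp: power_add algebra_simps)
  qed
  then have "(\<lambda>j. \<Sum>i\<le>n. if i \<le> j then c n i * x (j - i) * z ^ j else 0)
      sums (\<Sum>i\<le>n. c n i * z ^ i * X)"
    by (rule sums_sum)
  also have "(\<lambda>j. \<Sum>i\<le>n. if i \<le> j then c n i * x (j - i) * z ^ j else 0) = (\<lambda>j. full j * z ^ j)"
    by (auto simp: full_def sum_distrib_right intro!: sum.cong)
  finally have full: "(\<lambda>j. full j * z ^ j) sums ((\<Sum>i\<le>n. c n i * z ^ i) * X)"
    by (simp add: sum_distrib_right)
  have corr: "(\<lambda>j. if j \<in> {..<n} then (\<Sum>i\<le>j. (c j i - c n i) * x (j - i)) * z ^ j else 0) sums P"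
    unfolding P_def by (rule sums_If_finite_set) simp
  have split: "(\<Sum>i\<le>min n j. c (min n j) i * x (j - i)) * z ^ j =
      (if j \<in> {..<n} then (\<Sum>i\<le>j. (c j i - c n i) * x (j - i)) * z ^ j else 0) + full j * z ^ j" for j
  proof (cases "j < n")
    case True
    have "full j = (\<Sum>i\<in>{..n} \<inter> {i. i \<le> j}. c n i * x (j - i))"
      unfolding full_def by (subst sum.inter_restrict) auto
    also have "{..n} \<inter> {i. i \<le> j} = {..j}" using True by auto
    finally show ?thesis using True
      by (simp add: min_def sum_subtractf algebra_simps)
  next
    case False
    then show ?thesis by (auto simp: full_def min_def intro!: sum.cong)
  qed
  have S: "(\<lambda>j. (\<Sum>i\<le>min n j. c (min n j) i * x (j - i)) * z ^ j)
      sums (P + (\<Sum>i\<le>n. c n i * z ^ i) * X)"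
    using sums_add[OF corr full] by (simp only: split)
  define W where "W = (\<Sum>j. g j * z ^ j)"
  have "(\<lambda>j. z * (g j * z ^ j) + k * z * ((\<Sum>i\<le>min n j. c (min n j) i * x (j - i)) * z ^ j))
      sums (z * W + k * z * (P + (\<Sum>i\<le>n. c n i * z ^ i) * X))"
    unfolding W_def by (rule sums_add[OF sums_mult[OF summable_sums[OF g]] sums_mult[OF S]])
  also have "(\<lambda>j. z * (g j * z ^ j) + k * z * ((\<Sum>i\<le>min n j. c (min n j) i * x (j - i)) * z ^ j))
      = (\<lambda>j. g (Suc j) * z ^ Suc j)"
    by (simp add: rec fun_eq_iff distrib_right distrib_left mult.assoc mult.left_commute)
  finally have "(\<lambda>j. g j * z ^ j) sums
      (z * W + k * z * (P + (\<Sum>i\<le>n. c n i * z ^ i) * X) + g 0 * z ^ 0)"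
    using sums_Suc_iff[of "\<lambda>j. g j * z ^ j"] by blast
  then have "W = z * W + k * z * (P + (\<Sum>i\<le>n. c n i * z ^ i) * X) + g 0"
    by (simp add: W_def sums_iff)
  then show ?thesis
    unfolding X_def[symmetric] P_def[symmetric] W_def[symmetric] by algebra
qed

lemma summable_bounded_power:
  fixes u :: "nat \<Rightarrow> complex"
  assumes "bounded (range u)" and "norm z < 1"
  shows "summable (\<lambda>j. u j * z ^ j)"
proof -
  obtain C where C: "norm (u j) \<le> C" for j
    using assms(1) by (auto simp: bounded_iff)
  show ?thesis
  proof (rule summable_comparison_test')
    show "summable (\<lambda>j. C * norm z ^ j)"
      using assms(2) by (intro summable_mult summable_geometric) simp
    show "norm (u j * z ^ j) \<le> C * norm z ^ j" for j
      by (simp add: norm_mult norm_power C mult_right_mono)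
  qed
qed

section \<open>Functions that are polynomial on a rational curve\<close>

text \<open>Functions of \<open>s\<close> and \<open>z\<close> that become polynomials in \<open>z\<close> alone when \<open>s = N/M\<close> is substituted and
  denominators are cleared. The curve is written \<open>s M(z) = N(z)\<close>, so that the same polynomial \<open>G\<close>
  serves at points where \<open>M\<close> and \<open>N\<close> both vanish.\<close>

definition polynomial_on_curve ::
  "complex poly \<Rightarrow> complex poly \<Rightarrow> (complex \<Rightarrow> complex \<Rightarrow> complex) \<Rightarrow> bool" where
  "polynomial_on_curve M N \<phi> \<longleftrightarrow>
     (\<exists>K G. \<forall>s z. s * poly M z = poly N z \<longrightarrow> poly M z ^ K * \<phi> s z = poly G z)"

lemma polynomial_on_curve_poly: "polynomial_on_curve M N (\<lambda>s. poly p)"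
  unfolding polynomial_on_curve_def by (intro exI[of _ 0] exI[of _ p]) simp

lemma polynomial_on_curve_const: "polynomial_on_curve M N (\<lambda>s z. c)"
  unfolding polynomial_on_curve_def by (intro exI[of _ 0] exI[of _ "[:c:]"]) simp

lemma polynomial_on_curve_parameter: "polynomial_on_curve M N (\<lambda>s z. s)"
  unfolding polynomial_on_curve_def by (intro exI[of _ 1] exI[of _ N]) (simp add: mult.commute)

lemma polynomial_on_curve_power: "polynomial_on_curve M N (\<lambda>s z. z ^ j)"
  unfolding polynomial_on_curve_def
  by (intro exI[of _ 0] exI[of _ "monom 1 j"]) (simp add: poly_monom)

lemma polynomial_on_curve_variable: "polynomial_on_curve M N (\<lambda>s z. z)"
  using polynomial_on_curve_power[of M N 1] by simp

lemma polynomial_on_curve_mult: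
  assumes "polynomial_on_curve M N \<phi>" and "polynomial_on_curve M N \<psi>"
  shows "polynomial_on_curve M N (\<lambda>s z. \<phi> s z * \<psi> s z)"
proof -
  obtain K G K' G' where
    *: "\<And>s z. s * poly M z = poly N z \<Longrightarrow> poly M z ^ K * \<phi> s z = poly G z"
    "\<And>s z. s * poly M z = poly N z \<Longrightarrow> poly M z ^ K' * \<psi> s z = poly G' z"
    using assms unfolding polynomial_on_curve_def by metis
  have "poly M z ^ (K + K') * (\<phi> s z * \<psi> s z) = poly (G * G') z"
    if "s * poly M z = poly N z" for s z
    by (simp add: *[OF that, symmetric] power_add algebra_simps)
  then show ?thesis unfolding polynomial_on_curve_def by blast
qed

lemma polynomial_on_curve_add:
  assumes "polynomial_on_curve M N \<phi>" and "polynomial_on_curve M N \<psi>"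
  shows "polynomial_on_curve M N (\<lambda>s z. \<phi> s z + \<psi> s z)"
proof -
  obtain K G K' G' where
    *: "\<And>s z. s * poly M z = poly N z \<Longrightarrow> poly M z ^ K * \<phi> s z = poly G z"
    "\<And>s z. s * poly M z = poly N z \<Longrightarrow> poly M z ^ K' * \<psi> s z = poly G' z"
    using assms unfolding polynomial_on_curve_def by metis
  have "poly M z ^ (K + K') * (\<phi> s z + \<psi> s z) = poly (M ^ K' * G + M ^ K * G') z"
    if "s * poly M z = poly N z" for s z
    by (simp add: *[OF that, symmetric] power_add algebra_simps)
  then show ?thesis unfolding polynomial_on_curve_def by blast
qed

lemma polynomial_on_curve_diff:
  assumes "polynomial_on_curve M N \<phi>" and "polynomial_on_curve M N \<psi>"
  shows "polynomial_on_curve M N (\<lambda>s z. \<phi> s z - \<psi> s z)"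
  using polynomial_on_curve_add[OF assms(1)
      polynomial_on_curve_mult[OF polynomial_on_curve_const[of M N "-1"] assms(2)]] by simp

lemma polynomial_on_curve_sum:
  assumes "\<And>i. i \<in> S \<Longrightarrow> polynomial_on_curve M N (\<phi> i)"
  shows "polynomial_on_curve M N (\<lambda>s z. \<Sum>i\<in>S. \<phi> i s z)"
  using assms
  by (induction S rule: infinite_finite_induct) (simp_all add: polynomial_on_curve_const polynomial_on_curve_add)

lemmas polynomial_on_curve_intros =
  polynomial_on_curve_sum polynomial_on_curve_add polynomial_on_curve_diff
  polynomial_on_curve_mult polynomial_on_curve_parameter polynomial_on_curve_const

text \<open>Each value of the recursion is a polynomial in \<open>s\<close>, with a degree that depends on \<open>j\<close>; this is
  applied to the start-up values only.\<close>

lemma polynomial_on_curve_coupled: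
  assumes "\<And>s. coupled n a b s (u s) (y s)"
  shows "polynomial_on_curve M N (\<lambda>s z. u s j) \<and> polynomial_on_curve M N (\<lambda>s z. y s j)"
proof (induction j rule: less_induct)
  case (less j)
  show ?case
  proof (cases j)
    case 0
    then show ?thesis using assms by (simp add: coupled_def polynomial_on_curve_const)
  next
    case (Suc m)
    have u: "u s (Suc m) = u s m - s * (\<Sum>i\<le>min n m. a (min n m) i * y s (m - i))" for s
      using assms by (simp add: coupled_def)
    have y: "y s (Suc m) = y s m + (\<Sum>i\<le>min n m. b (min n m) i * u s (m - i))" for s
      using assms by (simp add: coupled_def)
    have IH: "polynomial_on_curve M N (\<lambda>s z. u s i)" "polynomial_on_curve M N (\<lambda>s z. y s i)"
      if "i \<le> m" for i
      using less[of i] that Suc by auto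
    show ?thesis
      unfolding Suc u y by (intro conjI polynomial_on_curve_intros IH) auto
  qed
qed

section \<open>Bounded solutions exist for finitely many large parameters only\<close>

text \<open>The characteristic function \<open>D(z) = (1 - z)\<^sup>2 + s z\<^sup>2 A(z) B(z)\<close> has \<open>D(0) = 1\<close>, and \<open>D(1)\<close> is proportional
  to \<open>s\<close>: for large \<open>s\<close> it has a root in the open unit disc, where the generating functions of bounded
  sequences converge. At the root these can be eliminated from the two generating function
  identities, and what remains is \<open>F(s, z) = 0\<close>, a condition on the finitely many start-up terms.
  As \<open>s = - (1 - z)\<^sup>2 / (z\<^sup>2 A B)\<close> there, \<open>z\<close> is a root of a single polynomial \<open>G\<close>, independent of \<open>s\<close>. It is
  not the zero polynomial because \<open>F(0, 1) = B(1)\<close>, and each of its roots belongs to one \<open>s\<close>.\<close>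

lemma finitely_many_bounded_solutions:
  fixes a b :: "nat \<Rightarrow> nat \<Rightarrow> complex"
  assumes "(\<Sum>i\<le>n. a n i) \<noteq> 0" and "(\<Sum>i\<le>n. b n i) \<noteq> 0"
  obtains S where "finite {s. norm s > S \<and>
    (\<exists>u y. coupled n a b s u y \<and> bounded (range u) \<and> bounded (range y))}"
proof -
  define A where "A = (\<Sum>i\<le>n. monom (a n i) i)"
  define B where "B = (\<Sum>i\<le>n. monom (b n i) i)"
  define M where "M = monom 1 2 * A * B"
  define N :: "complex poly" where "N = - ([:1, -1:] ^ 2)"
  have poly_A: "poly A z = (\<Sum>i\<le>n. a n i * z ^ i)" and poly_B: "poly B z = (\<Sum>i\<le>n. b n i * z ^ i)" for z
    by (simp_all add: A_def B_def poly_sum poly_monom)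
  have poly_N: "poly N z = - ((1 - z) ^ 2)" for z by (simp add: N_def)
  have poly_M: "poly M z = z ^ 2 * poly A z * poly B z" for z
    by (simp add: M_def poly_monom)
  have M1: "poly M 1 \<noteq> 0" using assms by (simp add: poly_M poly_A poly_B)
  obtain u y where uy: "\<And>s. coupled n a b s (u s) (y s)"
    using coupled_exists by metis
  define P where "P s z = (\<Sum>j<n. (\<Sum>i\<le>j. (a j i - a n i) * y s (j - i)) * z ^ j)" for s z
  define Q where "Q s z = (\<Sum>j<n. (\<Sum>i\<le>j. (b j i - b n i) * u s (j - i)) * z ^ j)" for s z
  define F where "F s z = poly B z * (1 - s * (z * P s z)) + (1 - z) * Q s z" for s z
  have "polynomial_on_curve M N F"
    unfolding F_def P_def Q_def
    by (intro polynomial_on_curve_intros polynomial_on_curve_poly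
          polynomial_on_curve_power polynomial_on_curve_variable
          polynomial_on_curve_coupled[OF uy, THEN conjunct1]
          polynomial_on_curve_coupled[OF uy, THEN conjunct2])
  then obtain K G where G: "\<And>s z. s * poly M z = poly N z \<Longrightarrow> poly M z ^ K * F s z = poly G z"
    unfolding polynomial_on_curve_def by blast
  \<comment> \<open>The point \<open>s = 0\<close>, \<open>z = 1\<close> lies on the curve because \<open>N\<close> vanishes there.\<close>
  have "poly M 1 ^ K * F 0 1 = poly G 1" by (rule G) (simp add: poly_N)
  then have "poly G 1 \<noteq> 0"
    using M1 assms(2) by (auto simp: F_def poly_B)
  then have "G \<noteq> 0" by auto
  then have fin: "finite ((\<lambda>z. poly N z / poly M z) ` {z. poly G z = 0})"
    by (intro finite_imageI poly_roots_finite)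
  \<comment> \<open>A bound on the degree of \<open>D\<close> that is independent of \<open>s\<close>.\<close>
  define d where "d = max (degree N) (degree M)"
  have "s \<in> (\<lambda>z. poly N z / poly M z) ` {z. poly G z = 0}"
    if s: "norm s > 2 ^ d / norm (poly M 1)" and "coupled n a b s u' y'"
      and "bounded (range u')" and "bounded (range y')" for s u' y'
  proof -
    have "u' = u s" "y' = y s"
      using coupled_unique[OF that(2) uy] by auto
    with that have bdd: "bounded (range (u s))" "bounded (range (y s))" by auto
    define D where "D = smult s M - N"
    have "degree D \<le> d"
      unfolding D_def d_def by (intro degree_diff_le) (auto intro: order.trans[OF degree_smult_le])
    then have "(2::real) ^ degree D \<le> 2 ^ d" by (intro power_increasing) auto
    also have "\<dots> < norm (poly D 1)"
      using s M1 by (simp add: D_def poly_N norm_mult field_simps)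
    finally have "2 ^ degree D * norm (poly D 0) < norm (poly D 1)"
      by (simp add: D_def poly_N poly_M)
    then obtain z where z: "norm z < 1" and Dz: "poly D z = 0"
      by (rule root_in_unit_disc)
    have curve: "s * poly M z = poly N z" using Dz by (simp add: D_def)
    have "z \<noteq> 1" using z by auto
    then have Nz: "poly N z \<noteq> 0" by (simp add: poly_N)
    have "z \<noteq> 0" using curve by (auto simp: poly_N poly_M)
    have sum_u: "summable (\<lambda>j. u s j * z ^ j)" and sum_y: "summable (\<lambda>j. y s j * z ^ j)"
      using summable_bounded_power z bdd by auto
    define U where "U = (\<Sum>j. u s j * z ^ j)"
    define Y where "Y = (\<Sum>j. y s j * z ^ j)"
    have U: "(1 - z) * U = 1 - s * z * (P s z + poly A z * Y)"
      using uy[of s] generating_function_identity[where g = "u s" and k = "-s" and n = n and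
          c = a and x = "y s", OF _ sum_u sum_y]
      by (simp add: coupled_def U_def Y_def P_def poly_A)
    have Y: "(1 - z) * Y = z * (Q s z + poly B z * U)"
      using uy[of s] generating_function_identity[where g = "y s" and k = 1 and n = n and
          c = b and x = "u s", OF _ sum_y sum_u]
      by (simp add: coupled_def U_def Y_def Q_def poly_B)
    \<comment> \<open>Multiply the equation for \<open>U\<close> by \<open>z B\<close>, replace \<open>s z\<^sup>2 A B\<close> by \<open>- (1 - z)\<^sup>2\<close>, insert the equation
      for \<open>Y\<close> and cancel \<open>1 - z\<close>: both \<open>U\<close> and \<open>Y\<close> disappear.\<close>
    have "s * (z ^ 2 * poly A z * poly B z) = - ((1 - z) ^ 2)"
      using curve by (simp add: poly_M poly_N)
    then have "z * F s z = 0"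
      using U Y unfolding F_def by algebra
    then have "F s z = 0" using \<open>z \<noteq> 0\<close> by simp
    then have "poly G z = 0" using G[OF curve] by simp
    moreover have "s = poly N z / poly M z"
      using curve Nz by (metis mult_eq_0_iff nonzero_eq_divide_eq)
    ultimately show ?thesis by blast
  qed
  then have "finite {s. norm s > 2 ^ d / norm (poly M 1) \<and>
    (\<exists>u y. coupled n a b s u y \<and> bounded (range u) \<and> bounded (range y))}"
    by (intro finite_subset[OF _ fin]) blast
  then show thesis by (rule that)
qed

section \<open>Extrapolation in local time\<close>

text \<open>The Lagrange basis polynomial of the node \<open>-i H\<close> among \<open>0, -H, \<dots>, -m H\<close>. Counting nodes backwards from
  the exchange time removes the dependence on \<open>j\<close>, so that the weights of the recursion are
  stationary from \<open>j = n\<close> on.\<close>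

definition shifted_lagrange :: "real \<Rightarrow> nat \<Rightarrow> nat \<Rightarrow> real \<Rightarrow> real" where
  "shifted_lagrange H m i \<tau> =
     (\<Prod>l\<in>{..m} - {i}. (real l * H + \<tau>) / (real l * H - real i * H))"

lemma extrapolation_shift:
  "extrapolation n H x j (real j * H + \<tau>) =
     (\<Sum>i\<le>min n j. shifted_lagrange H (min n j) i \<tau> *\<^sub>R x (j - i))"
proof -
  define m where "m = min n j"
  have m: "m \<le> j" by (simp add: m_def)
  have "(\<Prod>l\<in>{j - m..j} - {k}. (real j * H + \<tau> - real l * H) / (real k * H - real l * H))
      = shifted_lagrange H m (j - k) \<tau>" if "k \<in> {j - m..j}" for k
    unfolding shifted_lagrange_def using that m
    by (intro prod.reindex_bij_witness[of _ "\<lambda>l. j - l" "\<lambda>l. j - l"])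
       (auto simp: of_nat_diff algebra_simps)
  then have "extrapolation n H x j (real j * H + \<tau>)
      = (\<Sum>k\<in>{j - m..j}. shifted_lagrange H m (j - k) \<tau> *\<^sub>R x k)"
    by (simp add: extrapolation_def m_def[symmetric] Let_def)
  also have "\<dots> = (\<Sum>i\<le>m. shifted_lagrange H m i \<tau> *\<^sub>R x (j - i))"
    using m by (intro sum.reindex_bij_witness[of _ "\<lambda>i. j - i" "\<lambda>i. j - i"]) auto
  finally show ?thesis by (simp add: m_def)
qed

lemma continuous_shifted_lagrange [continuous_intros]:
  "continuous_on S (shifted_lagrange H m i)"
  unfolding shifted_lagrange_def divide_inverse by (intro continuous_intros)

text \<open>Interpolation reproduces constants: the sum minus \<open>1\<close> has degree at most \<open>m\<close> and vanishes at
  the \<open>m + 1\<close> nodes.\<close>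

lemma sum_shifted_lagrange:
  assumes "H > 0"
  shows "(\<Sum>i\<le>m. shifted_lagrange H m i \<tau>) = 1"
proof -
  define L where "L i = (\<Prod>l\<in>{..m} - {i}. smult (inverse (real l * H - real i * H)) [:real l * H, 1:])" for i
  have L: "poly (L i) t = shifted_lagrange H m i t" for i t
    by (simp add: L_def shifted_lagrange_def poly_prod divide_inverse algebra_simps)
  have "(\<Sum>i\<le>m. L i) = 1"
  proof (rule poly_eqI_degree[where A = "(\<lambda>k. - (real k * H)) ` {..m}"])
    fix t assume "t \<in> (\<lambda>k. - (real k * H)) ` {..m}"
    then obtain k where k: "k \<le> m" and t: "t = - (real k * H)" by auto
    have "shifted_lagrange H m i t = (if i = k then 1 else 0)" if "i \<le> m" for i
    proof (cases "i = k")
      case True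
      then show ?thesis using assms
        by (auto simp: shifted_lagrange_def t intro!: prod.neutral)
    next
      case False
      then show ?thesis using k
        by (auto simp: shifted_lagrange_def t intro!: prod_zero)
    qed
    then show "poly (\<Sum>i\<le>m. L i) t = poly 1 t"
      using k by (simp add: poly_sum L)
  next
    have inj: "inj_on (\<lambda>k. - (real k * H)) {..m}"
      using assms by (auto simp: inj_on_def)
    have card: "card ((\<lambda>k. - (real k * H)) ` {..m}) = Suc m"
      by (simp add: card_image[OF inj])
    have "degree (L i) \<le> m" if "i \<le> m" for i
    proof -
      have "degree (L i) \<le> (\<Sum>l\<in>{..m} - {i}. 1)"
        unfolding L_def
        by (intro order.trans[OF degree_prod_sum_le] sum_mono order.trans[OF degree_smult_le]) auto
      then show ?thesis using that by (simp add: card_Diff_singleton)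
    qed
    then have "degree (\<Sum>i\<le>m. L i) \<le> m"
      by (intro degree_sum_le) auto
    then show "degree (\<Sum>i\<le>m. L i) < card ((\<lambda>k. - (real k * H)) ` {..m})"
      by (simp add: card)
    show "degree (1 :: real poly) < card ((\<lambda>k. - (real k * H)) ` {..m})"
      by (simp add: card)
  qed
  then have "poly (\<Sum>i\<le>m. L i) \<tau> = 1" by simp
  then show ?thesis by (simp add: poly_sum L)
qed

section \<open>One exchange interval as a quadrature rule\<close>

lemma continuous_on_translated:
  fixes g :: "real \<Rightarrow> 'v::topological_space"
  assumes "continuous_on UNIV g"
  shows "continuous_on UNIV (\<lambda>\<tau>. g (t + \<tau>))"
  by (intro continuous_on_compose2[OF assms] continuous_intros) auto

lemma steps_quadrature:
  assumes "\<And>g y. continuous_on UNIV g \<Longrightarrow> \<Phi> h (\<lambda>\<tau> u. g \<tau>) y = y + q g"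
    and "continuous_on UNIV (g :: real \<Rightarrow> 'v :: real_normed_vector)"
  shows "steps k \<Phi> h (\<lambda>\<tau> u. g \<tau>) y = y + (\<Sum>i<k. q (\<lambda>\<tau>. g (real i * h + \<tau>)))"
proof (induction k)
  case 0
  then show ?case by simp
next
  case (Suc k)
  have "continuous_on UNIV (\<lambda>\<tau>. g (real k * h + \<tau>))"
    using assms(2) by (rule continuous_on_translated)
  then show ?case by (simp add: Suc assms(1))
qed

text \<open>The steps within an exchange interval compose to one linear rule \<open>I H\<close>. Its moments of positive
  order are uncontrolled at a given \<open>H\<close>, since consistency constrains the scheme only as the step
  tends to zero with a fixed right-hand side. For a constant integrand it does give the sign, for all small \<open>H\<close>
  and whatever the number of steps is, because the step \<open>H / k H\<close> is at most \<open>H\<close>.\<close>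

lemma exchange_step_quadrature:
  fixes \<Phi> :: "(real ^ 'a::finite) scheme"
  assumes "integration_scheme \<Phi>" and k: "\<And>H. H > 0 \<Longrightarrow> k H \<ge> 1" and e: "e \<noteq> 0"
  obtains \<delta> I where "\<delta> > 0"
    and "\<And>H g y. H > 0 \<Longrightarrow> continuous_on UNIV g \<Longrightarrow>
           steps (k H) \<Phi> (H / real (k H)) (\<lambda>\<tau> u. g \<tau>) y = y + I H g"
    and "\<And>H S c g. H > 0 \<Longrightarrow> finite (S :: nat set) \<Longrightarrow> (\<And>i. i \<in> S \<Longrightarrow> continuous_on UNIV (g i)) \<Longrightarrow>
           I H (\<lambda>\<tau>. \<Sum>i\<in>S. c i *\<^sub>R g i \<tau>) = (\<Sum>i\<in>S. c i *\<^sub>R I H (g i))"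
    and "\<And>H. 0 < H \<Longrightarrow> H < \<delta> \<Longrightarrow> e \<bullet> I H (\<lambda>\<tau>. e) > 0"
proof -
  obtain Q where Q0: "\<forall>h>0.
      (\<forall>g y. continuous_on UNIV g \<longrightarrow> \<Phi> h (\<lambda>\<tau> u. g \<tau>) y = y + Q h g) \<and>
      (\<forall>g1 g2 a b. continuous_on UNIV g1 \<longrightarrow> continuous_on UNIV g2 \<longrightarrow>
         Q h (\<lambda>\<tau>. a *\<^sub>R g1 \<tau> + b *\<^sub>R g2 \<tau>) = a *\<^sub>R Q h g1 + b *\<^sub>R Q h g2)"
    using assms(1) unfolding integration_scheme_def linear_quadrature_def by (elim conjE exE)
  have Q: "\<Phi> h (\<lambda>\<tau> u. g \<tau>) y = y + Q h g" if "h > 0" "continuous_on UNIV g" for h g y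
    using Q0 that by simp
  have Q_lin: "Q h (\<lambda>\<tau>. a *\<^sub>R g1 \<tau> + b *\<^sub>R g2 \<tau>) = a *\<^sub>R Q h g1 + b *\<^sub>R Q h g2"
    if "h > 0" "continuous_on UNIV g1" "continuous_on UNIV g2" for h g1 g2 a b
    using Q0 that by simp
  define I where "I H g = (\<Sum>i<k H. Q (H / real (k H)) (\<lambda>\<tau>. g (real i * (H / real (k H)) + \<tau>)))" for H g
  have h: "H / real (k H) > 0" if "H > 0" for H
    using k[OF that] that by simp
  have I_lin: "I H (\<lambda>\<tau>. a *\<^sub>R g1 \<tau> + b *\<^sub>R g2 \<tau>) = a *\<^sub>R I H g1 + b *\<^sub>R I H g2"
    if "H > 0" "continuous_on UNIV g1" "continuous_on UNIV g2" for H g1 g2 a b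
  proof -
    have "continuous_on UNIV (\<lambda>\<tau>. g1 (t + \<tau>))" "continuous_on UNIV (\<lambda>\<tau>. g2 (t + \<tau>))" for t
      using that by (auto intro: continuous_on_translated)
    then show ?thesis
      unfolding I_def by (simp add: Q_lin h that sum.distrib scaleR_sum_right)
  qed
  have I_zero: "I H (\<lambda>\<tau>. 0) = 0" if "H > 0" for H
    using I_lin[OF that, of "\<lambda>_. 0" "\<lambda>_. 0" 0 0] by simp
  have I_sum: "I H (\<lambda>\<tau>. \<Sum>i\<in>S. c i *\<^sub>R g i \<tau>) = (\<Sum>i\<in>S. c i *\<^sub>R I H (g i))"
    if H: "H > 0" and "finite (S :: nat set)" "\<And>i. i \<in> S \<Longrightarrow> continuous_on UNIV (g i)" for H S c g
    using that(2,3)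
  proof (induction S rule: finite_induct)
    case empty
    then show ?case using I_zero H by simp
  next
    case (insert i S)
    have "continuous_on UNIV (\<lambda>\<tau>. \<Sum>i\<in>S. c i *\<^sub>R g i \<tau>)"
      using insert.prems by (intro continuous_intros) auto
    then show ?case
      using insert I_lin[OF H, of "g i" "\<lambda>\<tau>. \<Sum>i\<in>S. c i *\<^sub>R g i \<tau>" "c i" 1] by simp
  qed
  have "((\<lambda>h. (\<Phi> h (\<lambda>\<tau> u. e) 0 - 0) /\<^sub>R h) \<longlongrightarrow> e) (at_right 0)"
  proof -
    have "consistent \<Phi>"
      using assms(1) by (simp add: integration_scheme_def)
    moreover have "continuous_on UNIV (\<lambda>(\<tau> :: real, u :: real ^ 'a). e)"
      by (simp add: case_prod_unfold)
    moreover have "\<exists>L. \<forall>\<tau>::real. L-lipschitz_on UNIV (\<lambda>u :: real ^ 'a. e)"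
      by (intro exI[of _ 0] allI lipschitz_onI) auto
    ultimately show ?thesis
      unfolding consistent_def by blast
  qed
  then have "((\<lambda>h. e \<bullet> ((\<Phi> h (\<lambda>\<tau> u. e) 0 - 0) /\<^sub>R h)) \<longlongrightarrow> e \<bullet> e) (at_right 0)"
    by (intro tendsto_intros)
  then have "eventually (\<lambda>h. 0 < e \<bullet> ((\<Phi> h (\<lambda>\<tau> u. e) 0 - 0) /\<^sub>R h)) (at_right 0)"
    using e by (intro order_tendstoD) auto
  then obtain \<delta> where \<delta>: "\<delta> > 0" and
    pos: "\<And>h. 0 < h \<Longrightarrow> h < \<delta> \<Longrightarrow> 0 < e \<bullet> ((\<Phi> h (\<lambda>\<tau> u. e) 0 - 0) /\<^sub>R h)"
    unfolding eventually_at_right_field by blast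
  have I_pos: "e \<bullet> I H (\<lambda>\<tau>. e) > 0" if "0 < H" "H < \<delta>" for H
  proof -
    define h where "h = H / real (k H)"
    have h0: "h > 0" using h that by (simp add: h_def)
    have "h \<le> H" using k[OF \<open>0 < H\<close>] that by (simp add: h_def field_simps)
    then have "0 < e \<bullet> ((\<Phi> h (\<lambda>\<tau> u. e) 0 - 0) /\<^sub>R h)"
      using pos[of h] h0 that by simp
    then have "0 < e \<bullet> Q h (\<lambda>\<tau>. e)"
      using h0 Q[of h "\<lambda>\<tau>. e" 0] by (simp add: zero_less_mult_iff zero_less_divide_iff)
    then show ?thesis
      using k[OF \<open>0 < H\<close>] by (simp add: I_def h_def sum_constant_scaleR zero_less_mult_iff del: sum_constant)
  qed
  have I_steps: "steps (k H) \<Phi> (H / real (k H)) (\<lambda>\<tau> u. g \<tau>) y = y + I H g"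
    if "H > 0" "continuous_on UNIV g" for H g y
    unfolding I_def by (rule steps_quadrature) (use that h Q in auto)
  show thesis
    by (rule that[OF \<delta> I_steps I_sum I_pos])
qed

section \<open>The harmonic oscillator\<close>

text \<open>The norm is constant along solutions.\<close>

lemma skew_linear_stable:
  fixes f :: "'v::real_inner \<Rightarrow> 'v"
  assumes "\<And>z. f z \<bullet> z = 0"
  shows "stable_system f"
  unfolding stable_system_def
proof (intro allI impI)
  fix x :: "real \<Rightarrow> 'v"
  assume x: "\<forall>t\<ge>0. (x has_vector_derivative f (x t)) (at t within {0..})"
  have "((\<lambda>t. x t \<bullet> x t) has_field_derivative 0) (at t within {0..})" if "t \<in> {0..}" for t
  proof -
    have "(x has_derivative (\<lambda>h. h *\<^sub>R f (x t))) (at t within {0..})"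
      using x that by (simp add: has_vector_derivative_def)
    from has_derivative_inner[OF this this] show ?thesis
      using assms[of "x t"] by (simp add: has_field_derivative_def inner_commute lambda_zero)
  qed
  then obtain c where c: "\<And>t. t \<ge> 0 \<Longrightarrow> x t \<bullet> x t = c"
    using has_field_derivative_zero_constant[of "{0..}" "\<lambda>t. x t \<bullet> x t"] by auto
  have "norm v \<le> sqrt c" if "v \<in> x ` {0..}" for v
    using that c by (auto simp: norm_eq_sqrt_inner)
  then show "bounded (x ` {0..})" unfolding bounded_iff by blast
qed

definition outer :: "real \<Rightarrow> real ^ 'b \<Rightarrow> real ^ 'a \<Rightarrow> real ^ 'b ^ 'a" where
  "outer c p q = (\<chi> i j. c * q $ i * p $ j)"

lemma outer_mult: "outer c p q *v x = (c * (p \<bullet> x)) *\<^sub>R q"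
  by (simp add: outer_def vec_eq_iff matrix_vector_mult_def inner_vec_def sum_distrib_left mult_ac)

text \<open>The oscillator lives in one direction \<open>p\<close> of subsystem 1 and one direction \<open>q\<close> of subsystem 2. Both
  diagonal blocks are zero, so that every integration reduces to quadrature.\<close>

definition oscillator :: "real ^ 'a \<Rightarrow> real ^ 'b \<Rightarrow> real \<Rightarrow> ('a::finite, 'b::finite) state \<Rightarrow> ('a, 'b) state" where
  "oscillator p q \<omega> = block_rhs 0 (outer (-\<omega>) q p) (outer \<omega> p q) 0"

lemma oscillator_apply:
  "oscillator p q \<omega> z = ((- \<omega> * (q \<bullet> snd z)) *\<^sub>R p, (\<omega> * (p \<bullet> fst z)) *\<^sub>R q)"
  by (simp add: oscillator_def block_rhs_def outer_mult case_prod_unfold matrix_vector_mult_0)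

lemma oscillator_skew: "oscillator p q \<omega> z \<bullet> z = 0"
  by (simp add: oscillator_apply inner_prod_def)

lemma oscillator_diff: "oscillator p q \<omega> z - oscillator p q \<omega> z' = oscillator p q \<omega> (z - z')"
  by (simp add: oscillator_apply inner_diff_right algebra_simps)

lemma oscillator_continuous: "continuous_on UNIV (oscillator p q \<omega>)"
  unfolding oscillator_apply[abs_def] by (intro continuous_intros)

section \<open>Cosimulation of the oscillator\<close>

lemma cosimulation_exists:
  obtains x where "x 0 = c" and "cosimulation n k1 k2 \<Phi>1 \<Phi>2 f H x"
proof -
  have ext: "extrapolation n H x j = extrapolation n H y j"
    if "\<And>i. i \<le> j \<Longrightarrow> x i = y i" for x y :: "nat \<Rightarrow> 'v::real_vector" and j
    unfolding extrapolation_def Let_def using that by (intro ext sum.cong) auto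
  define F where "F j x =
    (steps (k1 H) \<Phi>1 (H / real (k1 H))
       (\<lambda>\<tau> u. fst (f (u, extrapolation n H (\<lambda>i. snd (x i)) j (real j * H + \<tau>)))) (fst (x j)),
     steps (k2 H) \<Phi>2 (H / real (k2 H))
       (\<lambda>\<tau> u. snd (f (extrapolation n H (\<lambda>i. fst (x i)) j (real j * H + \<tau>), u))) (snd (x j)))" for j x
  have "F j x = F j y" if eq: "\<And>i. i \<le> j \<Longrightarrow> x i = y i" for j x y
  proof -
    have "extrapolation n H (\<lambda>i. fst (x i)) j = extrapolation n H (\<lambda>i. fst (y i)) j"
         "extrapolation n H (\<lambda>i. snd (x i)) j = extrapolation n H (\<lambda>i. snd (y i)) j"
      using eq by (intro ext; simp)+
    then show ?thesis
      using eq[of j] by (simp add: F_def)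
  qed
  then obtain x where x0: "x 0 = c" and x: "\<And>j. x (Suc j) = F j x"
    using course_of_values_recursion[of F c] by blast
  have "cosimulation n k1 k2 \<Phi>1 \<Phi>2 f H x"
    unfolding cosimulation_def Let_def x F_def by simp
  with x0 show thesis by (rule that)
qed

lemma extrapolated_oscillation:
  fixes p :: "'v::real_vector" and q :: "'w::real_inner"
  shows "(c * (q \<bullet> extrapolation n H z j (real j * H + \<tau>))) *\<^sub>R p =
    (\<Sum>i\<le>min n j. (c * (q \<bullet> z (j - i))) *\<^sub>R (shifted_lagrange H (min n j) i \<tau> *\<^sub>R p))"
  unfolding extrapolation_shift
  by (simp add: inner_sum_right sum_distrib_left scaleR_sum_left mult_ac)

lemma bounded_if_window_nonexpansive:
  fixes x :: "nat \<Rightarrow> 'v::real_normed_vector"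
  assumes "\<And>j. j \<ge> n \<Longrightarrow> norm (x (Suc j)) \<le> (MAX i\<in>{j - n..j}. norm (x i))"
  shows "bounded (range x)"
proof -
  define C where "C = (MAX i\<in>{..n}. norm (x i))"
  have "norm (x j) \<le> C" for j
  proof (induction j rule: less_induct)
    case (less j)
    show ?case
    proof (cases "j \<le> n")
      case True
      then show ?thesis unfolding C_def by (intro Max_ge) auto
    next
      case False
      then obtain m where m: "j = Suc m" "m \<ge> n" by (cases j) auto
      have "norm (x j) \<le> (MAX i\<in>{m - n..m}. norm (x i))"
        using assms m by simp
      also have "\<dots> \<le> C"
        using less m by (intro Max.boundedI) auto
      finally show ?thesis .
    qed
  qed
  then show ?thesis by (auto simp: bounded_iff)
qed

text \<open>A large frequency is chosen at the fixed exchange step size, avoiding the finitely many values of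
  \<open>\<omega>\<^sup>2\<close> for which the numerical solution from \<open>(p, 0)\<close> could be bounded. That the zero sequence is a
  numerical solution, too, provides the comparison for B-stability.\<close>

lemma oscillator_unstable:
  fixes \<Phi>1 :: "(real ^ 'a::finite) scheme" and \<Phi>2 :: "(real ^ 'b::finite) scheme"
    and n :: nat and k1 k2 :: "real \<Rightarrow> nat"
  assumes "integration_scheme \<Phi>1" and "integration_scheme \<Phi>2"
    and "\<And>H. H > 0 \<Longrightarrow> k1 H \<ge> 1" and "\<And>H. H > 0 \<Longrightarrow> k2 H \<ge> 1"
  obtains p q \<omega> H x where "H > 0"
    and "cosimulation n k1 k2 \<Phi>1 \<Phi>2 (oscillator p q \<omega>) H x" and "\<not> bounded (range x)"
    and "cosimulation n k1 k2 \<Phi>1 \<Phi>2 (oscillator p q \<omega>) H (\<lambda>j. 0)"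
proof -
  define p :: "real ^ 'a" where "p = axis undefined 1"
  define q :: "real ^ 'b" where "q = axis undefined 1"
  have p: "p \<bullet> p = 1" "p \<noteq> 0" and q: "q \<bullet> q = 1" "q \<noteq> 0"
    by (auto simp: p_def q_def inner_axis_axis)
  obtain \<delta>1 I1 where \<delta>1: "\<delta>1 > 0"
    and steps1: "\<And>H g y. H > 0 \<Longrightarrow> continuous_on UNIV g \<Longrightarrow>
           steps (k1 H) \<Phi>1 (H / real (k1 H)) (\<lambda>\<tau> u. g \<tau>) y = y + I1 H g"
    and lin1: "\<And>H S c g. H > 0 \<Longrightarrow> finite (S :: nat set) \<Longrightarrow> (\<And>i. i \<in> S \<Longrightarrow> continuous_on UNIV (g i)) \<Longrightarrow>
           I1 H (\<lambda>\<tau>. \<Sum>i\<in>S. c i *\<^sub>R g i \<tau>) = (\<Sum>i\<in>S. c i *\<^sub>R I1 H (g i))"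
    and pos1: "\<And>H. 0 < H \<Longrightarrow> H < \<delta>1 \<Longrightarrow> p \<bullet> I1 H (\<lambda>\<tau>. p) > 0"
    by (rule exchange_step_quadrature[where k = k1, OF assms(1,3) p(2)]) blast+
  obtain \<delta>2 I2 where \<delta>2: "\<delta>2 > 0"
    and steps2: "\<And>H g y. H > 0 \<Longrightarrow> continuous_on UNIV g \<Longrightarrow>
           steps (k2 H) \<Phi>2 (H / real (k2 H)) (\<lambda>\<tau> u. g \<tau>) y = y + I2 H g"
    and lin2: "\<And>H S c g. H > 0 \<Longrightarrow> finite (S :: nat set) \<Longrightarrow> (\<And>i. i \<in> S \<Longrightarrow> continuous_on UNIV (g i)) \<Longrightarrow>
           I2 H (\<lambda>\<tau>. \<Sum>i\<in>S. c i *\<^sub>R g i \<tau>) = (\<Sum>i\<in>S. c i *\<^sub>R I2 H (g i))"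
    and pos2: "\<And>H. 0 < H \<Longrightarrow> H < \<delta>2 \<Longrightarrow> q \<bullet> I2 H (\<lambda>\<tau>. q) > 0"
    by (rule exchange_step_quadrature[where k = k2, OF assms(2,4) q(2)]) blast+
  \<comment> \<open>One exchange step size is fixed; only the frequency varies below.\<close>
  define H where "H = min \<delta>1 \<delta>2 / 2"
  have H: "H > 0" "H < \<delta>1" "H < \<delta>2"
    using \<delta>1 \<delta>2 by (auto simp: H_def min_def)
  \<comment> \<open>Only the \<open>p\<close> and \<open>q\<close> components of the quadrature results act back on the other subsystem.\<close>
  define a where "a m i = p \<bullet> I1 H (\<lambda>\<tau>. shifted_lagrange H m i \<tau> *\<^sub>R p)" for m i
  define b where "b m i = q \<bullet> I2 H (\<lambda>\<tau>. shifted_lagrange H m i \<tau> *\<^sub>R q)" for m i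
  have cont: "continuous_on UNIV (\<lambda>\<tau>. shifted_lagrange H m i \<tau> *\<^sub>R v)"
    for m i and v :: "'v::real_normed_vector"
    by (intro continuous_intros)
  have cont_sum: "continuous_on UNIV (\<lambda>\<tau>. \<Sum>i\<le>m. c i *\<^sub>R (shifted_lagrange H m i \<tau> *\<^sub>R v))"
    for m c and v :: "'v::real_normed_vector"
    by (intro continuous_intros)
  have sum_lagrange: "(\<lambda>\<tau>. \<Sum>i\<le>n. 1 *\<^sub>R (shifted_lagrange H n i \<tau> *\<^sub>R v)) = (\<lambda>\<tau>. v)"
    for v :: "'v::real_vector"
    by (simp add: scaleR_sum_left[symmetric] sum_shifted_lagrange[OF H(1)])
  have "(\<Sum>i\<le>n. a n i) = p \<bullet> I1 H (\<lambda>\<tau>. p)"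
    using lin1[OF H(1), of "{..n}" "\<lambda>i \<tau>. shifted_lagrange H n i \<tau> *\<^sub>R p" "\<lambda>i. 1", OF _ cont]
    unfolding sum_lagrange by (simp add: a_def inner_sum_right)
  then have sum_a: "(\<Sum>i\<le>n. a n i) \<noteq> 0" using pos1[OF H(1,2)] by simp
  have "(\<Sum>i\<le>n. b n i) = q \<bullet> I2 H (\<lambda>\<tau>. q)"
    using lin2[OF H(1), of "{..n}" "\<lambda>i \<tau>. shifted_lagrange H n i \<tau> *\<^sub>R q" "\<lambda>i. 1", OF _ cont]
    unfolding sum_lagrange by (simp add: b_def inner_sum_right)
  then have sum_b: "(\<Sum>i\<le>n. b n i) \<noteq> 0" using pos2[OF H(1,3)] by simp

  have cosim: "cosimulation n k1 k2 \<Phi>1 \<Phi>2 (oscillator p q \<omega>) H x \<longleftrightarrow>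
      (\<forall>j. fst (x (Suc j)) = fst (x j) + (\<Sum>i\<le>min n j. (- \<omega> * (q \<bullet> snd (x (j - i)))) *\<^sub>R
              I1 H (\<lambda>\<tau>. shifted_lagrange H (min n j) i \<tau> *\<^sub>R p)) \<and>
           snd (x (Suc j)) = snd (x j) + (\<Sum>i\<le>min n j. (\<omega> * (p \<bullet> fst (x (j - i)))) *\<^sub>R
              I2 H (\<lambda>\<tau>. shifted_lagrange H (min n j) i \<tau> *\<^sub>R q)))" for \<omega> x
    unfolding cosimulation_def Let_def oscillator_apply fst_conv snd_conv extrapolated_oscillation
    by (simp only: steps1[OF H(1) cont_sum] steps2[OF H(1) cont_sum]
        lin1[OF H(1) finite_atMost cont] lin2[OF H(1) finite_atMost cont])

  have "(\<Sum>i\<le>n. complex_of_real (a n i)) \<noteq> 0" "(\<Sum>i\<le>n. complex_of_real (b n i)) \<noteq> 0"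
    using sum_a sum_b by (simp_all only: of_real_sum[symmetric] of_real_eq_0_iff not_False_eq_True)
  then obtain S where fin: "finite {s. norm s > S \<and>
    (\<exists>u y. coupled n (\<lambda>m i. complex_of_real (a m i)) (\<lambda>m i. complex_of_real (b m i)) s u y
       \<and> bounded (range u) \<and> bounded (range y))}" (is "finite ?Bad")
    by (rule finitely_many_bounded_solutions)
  have "inj_on (\<lambda>\<omega>. complex_of_real (\<omega> ^ 2)) {max 1 S<..}"
    by (auto simp: inj_on_def power2_eq_iff simp del: of_real_power)
  then have "infinite ((\<lambda>\<omega>. complex_of_real (\<omega> ^ 2)) ` {max 1 S<..})"
    by (simp add: finite_image_iff infinite_Ioi)
  then have "\<not> (\<lambda>\<omega>. complex_of_real (\<omega> ^ 2)) ` {max 1 S<..} \<subseteq> ?Bad"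
    using fin finite_subset by blast
  then obtain \<omega> where \<omega>: "\<omega> > max 1 S" and not_bad: "complex_of_real (\<omega> ^ 2) \<notin> ?Bad"
    unfolding image_subset_iff by blast
  have "S < \<omega> * 1" using \<omega> by simp
  also have "\<omega> * 1 \<le> \<omega> ^ 2" using \<omega> unfolding power2_eq_square by (intro mult_left_mono) auto
  finally have large: "norm (complex_of_real (\<omega> ^ 2)) > S"
    by (simp only: norm_of_real)

  obtain x where x0: "x 0 = (p, 0)" and x: "cosimulation n k1 k2 \<Phi>1 \<Phi>2 (oscillator p q \<omega>) H x"
    by (rule cosimulation_exists)
  define u where "u j = complex_of_real (p \<bullet> fst (x j))" for j
  define y where "y j = complex_of_real ((q \<bullet> snd (x j)) / \<omega>)" for j
  have v: "complex_of_real (q \<bullet> snd (x j)) = of_real \<omega> * y j" for j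
    using \<omega> by (simp add: y_def)
  have "u (Suc j) = u j - of_real (\<omega> ^ 2) * (\<Sum>i\<le>min n j. of_real (a (min n j) i) * y (j - i))" for j
  proof -
    have "p \<bullet> fst (x (Suc j)) =
        p \<bullet> fst (x j) - \<omega> * (\<Sum>i\<le>min n j. a (min n j) i * (q \<bullet> snd (x (j - i))))"
      using x[unfolded cosim]
      by (simp add: inner_diff_right inner_sum_right a_def sum_distrib_left sum_negf mult_ac)
    then have "u (Suc j) = u j - of_real \<omega> * (\<Sum>i\<le>min n j. of_real (a (min n j) i) * (of_real \<omega> * y (j - i)))"
      by (simp add: u_def v)
    then show ?thesis
      by (simp add: sum_distrib_left power2_eq_square mult_ac)
  qed
  moreover have "y (Suc j) = y j + (\<Sum>i\<le>min n j. of_real (b (min n j) i) * u (j - i))" for j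
  proof -
    have "q \<bullet> snd (x (Suc j)) =
        q \<bullet> snd (x j) + \<omega> * (\<Sum>i\<le>min n j. b (min n j) i * (p \<bullet> fst (x (j - i))))"
      using x[unfolded cosim]
      by (simp add: inner_add_right inner_sum_right b_def sum_distrib_left mult_ac)
    then have "(q \<bullet> snd (x (Suc j))) / \<omega> =
        (q \<bullet> snd (x j)) / \<omega> + (\<Sum>i\<le>min n j. b (min n j) i * (p \<bullet> fst (x (j - i))))"
      using \<omega> by (simp add: add_divide_distrib)
    then show ?thesis
      unfolding y_def u_def by simp
  qed
  ultimately have "coupled n (\<lambda>m i. complex_of_real (a m i)) (\<lambda>m i. complex_of_real (b m i))
      (of_real (\<omega> ^ 2)) u y"
    by (simp add: coupled_def u_def y_def x0 p)
  with not_bad large have unbdd: "\<not> (bounded (range u) \<and> bounded (range y))"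
    by blast
  have "\<not> bounded (range x)"
  proof
    assume "bounded (range x)"
    then obtain C where C: "norm (x j) \<le> C" for j
      by (auto simp: bounded_iff)
    have np: "norm p = 1" "norm q = 1" using p q by (auto simp: norm_eq_sqrt_inner)
    have "norm (u j) \<le> C" for j
      using Cauchy_Schwarz_ineq2[of p "fst (x j)"] norm_fst_le[of "fst (x j)" "snd (x j)"] C[of j] np
      by (simp add: u_def)
    moreover have "norm (y j) \<le> C / \<omega>" for j
      using Cauchy_Schwarz_ineq2[of q "snd (x j)"] norm_snd_le[of "snd (x j)" "fst (x j)"] C[of j] np \<omega>
      by (simp add: y_def norm_divide divide_right_mono)
    ultimately have "bounded (range u)" "bounded (range y)"
      unfolding bounded_iff by blast+
    with unbdd show False by blast
  qed
  moreover have "cosimulation n k1 k2 \<Phi>1 \<Phi>2 (oscillator p q \<omega>) H (\<lambda>j. 0)"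
    unfolding cosim by simp
  ultimately show thesis
    using that H(1) x by blast
qed

section \<open>Failure of linear stability and of B-stability\<close>

theorem mainTheorem3:
  fixes \<Phi>1 :: "(real ^ 'a::finite) scheme" and \<Phi>2 :: "(real ^ 'b::finite) scheme"
    and n :: nat and k1 k2 :: "real \<Rightarrow> nat"
  assumes "integration_scheme \<Phi>1" and "integration_scheme \<Phi>2"
    and "\<And>H. H > 0 \<Longrightarrow> k1 H \<ge> 1" and "\<And>H. H > 0 \<Longrightarrow> k2 H \<ge> 1"
  shows "\<not> linearly_stable (cosimulation n k1 k2 \<Phi>1 \<Phi>2)
       \<and> \<not> B_stable n (cosimulation n k1 k2 \<Phi>1 \<Phi>2)"
proof -
  obtain p :: "real ^ 'a" and q :: "real ^ 'b" and \<omega> H x where H: "H > 0"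
    and x: "cosimulation n k1 k2 \<Phi>1 \<Phi>2 (oscillator p q \<omega>) H x" and unbdd: "\<not> bounded (range x)"
    and zero: "cosimulation n k1 k2 \<Phi>1 \<Phi>2 (oscillator p q \<omega>) H (\<lambda>j. 0)"
    by (rule oscillator_unstable[OF assms])
  have "stable_system (oscillator p q \<omega>)"
    by (intro skew_linear_stable oscillator_skew)
  then have "\<not> linearly_stable (cosimulation n k1 k2 \<Phi>1 \<Phi>2)"
    using H x unbdd unfolding linearly_stable_def oscillator_def by blast
  moreover have "\<not> B_stable n (cosimulation n k1 k2 \<Phi>1 \<Phi>2)"
  proof
    assume B: "B_stable n (cosimulation n k1 k2 \<Phi>1 \<Phi>2)"
    have "dissipative (oscillator p q \<omega>)"
      by (simp add: dissipative_def oscillator_diff oscillator_skew)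
    then have "norm (x (Suc j) - 0) \<le> (MAX i\<in>{j - n..j}. norm (x i - 0))" if "j \<ge> n" for j
      using B[unfolded B_stable_def, rule_format, of "oscillator p q \<omega>" H x "\<lambda>j. 0" j]
        oscillator_continuous[of p q \<omega>] H x zero that by simp
    then have "bounded (range x)"
      by (intro bounded_if_window_nonexpansive[of n]) simp
    with unbdd show False by contradiction
  qed
  ultimately show ?thesis by blast
qed

end
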